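(* For every $k\ge1$, with $n=3^k$ the number of variables, $\mathsf{D}_{\oplus}(\mathrm{MAJ}_3^{\otimes k})=\frac{n+1}{2}$.
   Context: $\mathrm{MAJ}_3\colon\{0,1\}^3\to\{-1,1\}$ takes value $-1$ iff at least two inputs are $1$. The recursive majority $\mathrm{MAJ}_3^{\otimes k}$ on $n=3^k$ variables is defined by $\mathrm{MAJ}_3^{\otimes 1}=\mathrm{MAJ}_3$ and, for $k>1$, $\mathrm{MAJ}_3^{\otimes k}=\mathrm{MAJ}_3(\mathrm{MAJ}_3^{\otimes k-1},\mathrm{MAJ}_3^{\otimes k-1},\mathrm{MAJ}_3^{\otimes k-1})$, the three inner copies being applied to disjoint blocks of $3^{k-1}$ variables (outputs $-1$/$1$ fed to the outer $\mathrm{MAJ}_3$ as bits $1$/$0$). A parity decision tree is a rooted binary tree whose internal nodes are labeled by parities $\bigoplus_{i\in S}x_i$, with two outgoing edges labeled by the possible parity values, and leaves labeled by $-1$ or $1$; $\mathsf{D}_{\oplus}(f)$ is the minimal depth of such a tree computing $f$. *)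

theory Defs
  imports Complex_Main
begin

text \<open>Points of \<open>{0,1}\<^sup>n\<close> are Boolean lists of length \<open>n\<close>, with \<^const>\<open>True\<close> for
  the bit \<open>1\<close>; coordinates are numbered from \<open>0\<close>. A function on \<open>{0,1}\<^sup>n\<close> is a function on
  lists of which only the values at lists of length \<open>n\<close> matter.\<close>

definition cube :: "nat \<Rightarrow> bool list set" where
  "cube n = {x. length x = n}"

definition maj3 :: "bool \<Rightarrow> bool \<Rightarrow> bool \<Rightarrow> int" where
  "maj3 a b c = (if of_bool a + of_bool b + of_bool c \<ge> (2::nat) then -1 else 1)"

text \<open>Intended for \<open>k \<ge> 1\<close> and arguments of length \<open>3 ^ k\<close>; the value at \<open>k = 0\<close> is only there
  to make the function total. The test \<open>= -1\<close> decodes the output \<open>-1\<close> as the bit \<open>1\<close> and the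
  output \<open>1\<close> as the bit \<open>0\<close>.\<close>

fun rec_maj3 :: "nat \<Rightarrow> bool list \<Rightarrow> int" where
  "rec_maj3 0 x = (if x ! 0 then -1 else 1)"
| "rec_maj3 (Suc 0) x = maj3 (x ! 0) (x ! 1) (x ! 2)"
| "rec_maj3 (Suc (Suc k)) x =
    (let m = 3 ^ Suc k in
     maj3 (rec_maj3 (Suc k) (take m x) = -1)
          (rec_maj3 (Suc k) (take m (drop m x)) = -1)
          (rec_maj3 (Suc k) (drop (2 * m) x) = -1))"

text \<open>In \<open>Node S t0 t1\<close> the query is the parity of the variables indexed by \<open>S\<close>; the computation
  continues in \<open>t0\<close> if the parity is \<open>0\<close> and in \<open>t1\<close> if it is \<open>1\<close>.\<close>

datatype pdt = Leaf int | Node "nat set" pdt pdt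

definition parity :: "nat set \<Rightarrow> bool list \<Rightarrow> bool" where
  "parity S x \<longleftrightarrow> odd (card {i \<in> S. x ! i})"

primrec pdt_over :: "nat \<Rightarrow> pdt \<Rightarrow> bool" where
  "pdt_over n (Leaf v) \<longleftrightarrow> v \<in> {-1, 1}"
| "pdt_over n (Node S t0 t1) \<longleftrightarrow> S \<subseteq> {..<n} \<and> pdt_over n t0 \<and> pdt_over n t1"

primrec pdt_eval :: "pdt \<Rightarrow> bool list \<Rightarrow> int" where
  "pdt_eval (Leaf v) x = v"
| "pdt_eval (Node S t0 t1) x = (if parity S x then pdt_eval t1 x else pdt_eval t0 x)"

primrec pdt_depth :: "pdt \<Rightarrow> nat" where
  "pdt_depth (Leaf v) = 0"
| "pdt_depth (Node S t0 t1) = Suc (max (pdt_depth t0) (pdt_depth t1))"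

definition pdt_computes :: "nat \<Rightarrow> pdt \<Rightarrow> (bool list \<Rightarrow> int) \<Rightarrow> bool" where
  "pdt_computes n t f \<longleftrightarrow> pdt_over n t \<and> (\<forall>x \<in> cube n. pdt_eval t x = f x)"

text \<open>The minimum exists whenever \<open>f\<close> takes values in \<open>{-1, 1}\<close> on the cube, since one can
  query all variables one after the other.\<close>

definition D_parity :: "nat \<Rightarrow> (bool list \<Rightarrow> int) \<Rightarrow> nat" where
  "D_parity n f = (LEAST d. \<exists>t. pdt_computes n t f \<and> pdt_depth t = d)"

end

theory Submission
  imports Defs
begin

text \<open>Lower bound: the Fourier coefficients at nonempty sets of a tree of depth \<open>d\<close> with leaves
  \<open>\<plusminus>1\<close> are integer multiples of \<open>2\<close> to the power \<open>1 - d\<close>. From \<open>2 maj3(u,v,w) = u + v + w - u v w\<close> the top coefficient of the recursive majority is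
  \<open>\<plusminus>2\<close> to the power \<open>-(n - 1) / 2\<close>, hence \<open>d \<ge> (n + 1) / 2\<close>.

  Upper bound: after one query \<open>a \<oplus> b\<close> the value of \<open>maj3(a,b,c)\<close> is a single variable, namely
  \<open>a\<close> if the parity is \<open>0\<close> and \<open>c\<close> otherwise. Doing this bottom up costs one query for each of
  the \<open>(n - 1) / 2\<close> gates, and one more query reads the remaining variable.\<close>

section \<open>Characters of the cube\<close>

text \<open>The index range comes from \<open>x\<close>, not from \<open>S\<close>, so
  \<open>char UNIV\<close> is the full character at every length and splits over
  concatenation.\<close>

definition char :: "nat set \<Rightarrow> bool list \<Rightarrow> int" where
  "char S x = (\<Prod>i<length x. if i \<in> S \<and> x ! i then -1 else 1)"

lemma char_eq_parity:
  assumes "S \<subseteq> {..<length x}"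
  shows "char S x = (if parity S x then -1 else 1)"
proof -
  have "{..<length x} \<inter> {i. i \<in> S \<and> x ! i} = {i \<in> S. x ! i}"
    using assms by auto
  then show ?thesis
    by (simp add: char_def parity_def prod.If_cases)
qed

lemma char_mult: "char S x * char Q x = char (sym_diff S Q) x"
  unfolding char_def prod.distrib[symmetric] by (rule prod.cong) auto

lemma char_Nil [simp]: "char S [] = 1"
  by (simp add: char_def)

lemma char_snoc:
  "char S (x @ [b]) = char S x * (if length x \<in> S \<and> b then -1 else 1)"
  by (simp add: char_def nth_append)

lemma char_UNIV_append: "char UNIV (x @ y) = char UNIV x * char UNIV y"
proof (induction y rule: rev_induct)
  case (snoc b y)
  then show ?case
    using char_snoc[of UNIV "x @ y" b] char_snoc[of UNIV y b] by simp
qed simp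

lemma sum_cube_add:
  "(\<Sum>x\<in>cube (m + n). f x) = (\<Sum>x\<in>cube m. \<Sum>y\<in>cube n. f (x @ y))"
proof -
  have "bij_betw (\<lambda>(x, y). x @ y) (cube m \<times> cube n) (cube (m + n))"
    by (rule bij_betw_byWitness[where f' = "\<lambda>z. (take m z, drop m z)"])
      (auto simp: cube_def)
  from sum.reindex_bij_betw[OF this, of f] show ?thesis
    by (simp add: sum.cartesian_product case_prod_beta)
qed

lemma cube_0: "cube 0 = {[]}"
  by (auto simp: cube_def)

lemma cube_1: "cube (Suc 0) = {[True], [False]}"
  by (auto simp: cube_def length_Suc_conv)

lemma sum_cube_Suc:
  "(\<Sum>x\<in>cube (Suc n). f x) = (\<Sum>x\<in>cube n. f (x @ [True]) + f (x @ [False]))"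
  using sum_cube_add[of f n 1] by (simp add: cube_1)

text \<open>Summing out one coordinate gives the factor 0 or 2, according to whether it lies in
  \<open>S\<close>.\<close>

lemma sum_char_dvd: "2 ^ n dvd (\<Sum>x\<in>cube n. char S x)"
proof (induction n)
  case 0
  then show ?case by (simp add: cube_0)
next
  case (Suc n)
  have "(\<Sum>x\<in>cube (Suc n). char S x) = (\<Sum>x\<in>cube n. char S x * (if n \<in> S then 0 else 2))"
    unfolding sum_cube_Suc by (rule sum.cong) (auto simp: char_snoc cube_def)
  then show ?case
    using Suc by (auto simp: sum_distrib_right[symmetric])
qed

lemma sum_char_UNIV:
  assumes "n > 0"
  shows "(\<Sum>x\<in>cube n. char UNIV x) = 0"
proof -
  obtain m where "n = Suc m" using assms gr0_implies_Suc by blast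
  then show ?thesis by (simp add: sum_cube_Suc char_snoc)
qed

section \<open>Granularity of parity decision trees\<close>

text \<open>Passing from \<open>t\<close> to \<open>1 - t\<close> makes the base case even for every \<open>S\<close>.\<close>

lemma pdt_granularity:
  assumes "pdt_over n t" and "pdt_depth t \<le> d"
  shows "2 ^ Suc n dvd 2 ^ d * (\<Sum>x\<in>cube n. (1 - pdt_eval t x) * char S x)"
  using assms
proof (induction t arbitrary: d S)
  case (Leaf v)
  then have "(2::int) dvd 1 - v" by auto
  then have "2 ^ Suc n dvd (1 - v) * (\<Sum>x\<in>cube n. char S x)"
    unfolding power_Suc using sum_char_dvd by (rule mult_dvd_mono)
  then show ?case by (simp add: sum_distrib_left[symmetric] dvd_mult)
next
  case (Node Q t0 t1)
  then obtain e where d: "d = Suc e" and "pdt_depth t0 \<le> e" "pdt_depth t1 \<le> e"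
    by (cases d) auto
  define c where "c t S = (\<Sum>x\<in>cube n. (1 - pdt_eval t x) * char S x)" for t S
  have IH: "2 ^ Suc n dvd 2 ^ e * c t0 R" "2 ^ Suc n dvd 2 ^ e * c t1 R" for R
    using Node \<open>pdt_depth t0 \<le> e\<close> \<open>pdt_depth t1 \<le> e\<close> unfolding c_def by auto
  \<comment> \<open>The indicators of the two branches are \<open>(1 + char Q x) / 2\<close> and
    \<open>(1 - char Q x) / 2\<close>; multiplying by \<open>char Q\<close> moves the coefficient
    from \<open>S\<close> to \<open>sym_diff S Q\<close>. The extra level of depth pays for the
    factor 2.\<close>
  have "2 * ((1 - pdt_eval (Node Q t0 t1) x) * char S x)
      = (1 - pdt_eval t0 x) * char S x + (1 - pdt_eval t0 x) * char (sym_diff S Q) x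
        + (1 - pdt_eval t1 x) * char S x - (1 - pdt_eval t1 x) * char (sym_diff S Q) x"
    if "x \<in> cube n" for x
  proof -
    have "char Q x = (if parity Q x then -1 else 1)"
      using that Node.prems by (intro char_eq_parity) (auto simp: cube_def)
    then show ?thesis
      unfolding char_mult[symmetric] by (simp add: algebra_simps)
  qed
  then have "2 * c (Node Q t0 t1) S
      = c t0 S + c t0 (sym_diff S Q) + c t1 S - c t1 (sym_diff S Q)"
    unfolding c_def sum_distrib_left sum.distrib[symmetric] sum_subtractf[symmetric]
    by (intro sum.cong) auto
  moreover have "2 ^ d * c (Node Q t0 t1) S = 2 ^ e * (2 * c (Node Q t0 t1) S)"
    by (simp add: d)
  ultimately have "2 ^ d * c (Node Q t0 t1) S
      = 2 ^ e * c t0 S + 2 ^ e * c t0 (sym_diff S Q)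
        + 2 ^ e * c t1 S - 2 ^ e * c t1 (sym_diff S Q)"
    by (simp only: distrib_left right_diff_distrib)
  then show ?case
    using IH unfolding c_def[symmetric] by (metis dvd_add dvd_diff)
qed

section \<open>The top coefficient of the recursive majority\<close>

text \<open>As level 0 is a single variable, the clauses for \<open>Suc 0\<close> and above become
  one rule, and inductions can start at \<open>k = 0\<close>.\<close>

lemma rec_maj3_append:
  assumes "length x = 3 ^ k" "length y = 3 ^ k" "length z = 3 ^ k"
  shows "rec_maj3 (Suc k) (x @ y @ z)
    = maj3 (rec_maj3 k x = -1) (rec_maj3 k y = -1) (rec_maj3 k z = -1)"
  using assms by (cases k) (auto simp: Let_def length_Suc_conv)

lemma rec_maj3_range: "rec_maj3 k x \<in> {-1, 1}"
  by (induction k x rule: rec_maj3.induct) (auto simp: maj3_def Let_def)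

lemma double_maj3:
  assumes "u \<in> {-1, 1}" "v \<in> {-1, 1}" "w \<in> {-1, 1}"
  shows "2 * maj3 (u = -1) (v = -1) (w = -1) = u + v + w - u * v * w"
  using assms by (auto simp: maj3_def)

text \<open>The Fourier coefficient at the full set, left unnormalised to stay in the
  integers.\<close>

definition top_sum :: "nat \<Rightarrow> int" where
  "top_sum k = (\<Sum>x\<in>cube (3 ^ k). rec_maj3 k x * char UNIV x)"

text \<open>Each linear term leaves a full character summed over another block, which vanishes; only
  the cubic term survives, and it factors over the three blocks.\<close>

lemma top_sum_Suc: "2 * top_sum (Suc k) = - (top_sum k ^ 3)"
proof -
  define m where "m = (3::nat) ^ k"
  define r where "r = rec_maj3 k"
  define s where "s = char UNIV"
  define q where "q x = r x * s x" for x
  have "2 * top_sum (Suc k)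
      = (\<Sum>x\<in>cube (m + (m + m)). 2 * rec_maj3 (Suc k) x * s x)"
    by (simp add: top_sum_def m_def s_def sum_distrib_left mult.assoc numeral_3_eq_3)
  also have "\<dots> = (\<Sum>x\<in>cube m. \<Sum>y\<in>cube m. \<Sum>z\<in>cube m.
      2 * rec_maj3 (Suc k) (x @ y @ z) * s (x @ y @ z))"
    by (simp only: sum_cube_add)
  also have "\<dots> = (\<Sum>x\<in>cube m. \<Sum>y\<in>cube m. \<Sum>z\<in>cube m.
      q x * (s y * s z) + s x * (q y * s z) + s x * (s y * q z) - q x * (q y * q z))"
  proof (intro sum.cong refl)
    fix x y z
    assume "x \<in> cube m" "y \<in> cube m" "z \<in> cube m"
    then have maj: "2 * rec_maj3 (Suc k) (x @ y @ z) = r x + r y + r z - r x * r y * r z"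
      unfolding r_def using double_maj3[OF rec_maj3_range rec_maj3_range rec_maj3_range]
      by (simp add: rec_maj3_append cube_def m_def)
    have char: "s (x @ y @ z) = s x * (s y * s z)"
      by (simp add: s_def char_UNIV_append)
    show "2 * rec_maj3 (Suc k) (x @ y @ z) * s (x @ y @ z)
      = q x * (s y * s z) + s x * (q y * s z) + s x * (s y * q z) - q x * (q y * q z)"
      unfolding maj char q_def by (simp add: algebra_simps)
  qed
  also have "\<dots> = - ((\<Sum>x\<in>cube m. q x) ^ 3)"
    using sum_char_UNIV[of m] unfolding s_def[symmetric]
    by (simp add: m_def sum.distrib sum_subtractf sum_distrib_left[symmetric]
        sum_distrib_right[symmetric] sum_negf power3_eq_cube mult.assoc)
  finally show ?thesis
    by (simp add: top_sum_def m_def q_def r_def s_def)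
qed

text \<open>Squaring removes the alternating sign and the halved exponent.\<close>

lemma top_sum_squared: "top_sum k ^ 2 = 2 ^ (3 ^ k + 1)"
proof (induction k)
  case 0
  show ?case by (simp add: top_sum_def cube_1 char_def)
next
  case (Suc k)
  have "4 * top_sum (Suc k) ^ 2 = (2 * top_sum (Suc k)) ^ 2"
    by (simp add: power_mult_distrib)
  also have "\<dots> = (top_sum k ^ 2) ^ 3"
    unfolding top_sum_Suc by (simp flip: power_mult)
  also have "\<dots> = 2 ^ ((3 ^ k + 1) * 3)"
    unfolding Suc by (simp only: power_mult)
  also have "(3 ^ k + 1) * 3 = 2 + (3 ^ Suc k + 1 :: nat)"
    by simp
  finally show ?case
    by (simp add: power_add)
qed

lemma pdt_depth_lower:
  assumes "pdt_computes (3 ^ k) t (rec_maj3 k)"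
  shows "3 ^ k + 1 \<le> 2 * pdt_depth t"
proof -
  define n where "n = (3::nat) ^ k"
  define d where "d = pdt_depth t"
  \<comment> \<open>The constant 1 contributes nothing, since the full character sums to 0.\<close>
  have "(\<Sum>x\<in>cube n. (1 - pdt_eval t x) * char UNIV x)
      = (\<Sum>x\<in>cube n. char UNIV x - rec_maj3 k x * char UNIV x)"
    using assms by (intro sum.cong) (auto simp: pdt_computes_def n_def algebra_simps)
  also have "\<dots> = - top_sum k"
    using sum_char_UNIV[of n] by (simp add: sum_subtractf top_sum_def n_def)
  finally have "2 ^ Suc n dvd 2 ^ d * top_sum k"
    using pdt_granularity[of n t d UNIV] assms
    by (simp add: pdt_computes_def n_def d_def)
  then have "(2 ^ Suc n) ^ 2 dvd (2 ^ d * top_sum k) ^ 2"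
    by (rule dvd_power_same)
  then have "(2::int) ^ (Suc n * 2) dvd 2 ^ (d * 2 + (n + 1))"
    by (simp only: power_mult_distrib top_sum_squared n_def[symmetric] power_mult
        power_add[of 2 "d * 2"])
  then have "Suc n * 2 \<le> d * 2 + (n + 1)"
    by (simp only: dvd_power_iff) simp
  then show ?thesis by (simp add: n_def d_def)
qed

section \<open>The optimal tree\<close>

text \<open>The tree \<open>reduce_tree k s c\<close> finds a variable \<open>v\<close> whose value is that of the recursive
  majority of the block of \<open>3 ^ k\<close> variables starting at \<open>s\<close>, and continues with \<open>c v\<close>.\<close>

fun reduce_tree :: "nat \<Rightarrow> nat \<Rightarrow> (nat \<Rightarrow> pdt) \<Rightarrow> pdt" where
  "reduce_tree 0 s c = c s"
| "reduce_tree (Suc k) s c =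
    reduce_tree k s (\<lambda>u. reduce_tree k (s + 3 ^ k) (\<lambda>v. reduce_tree k (s + 2 * 3 ^ k)
      (\<lambda>w. Node {u, v} (c u) (c w))))"

lemma pdt_over_reduce_tree:
  assumes "s + 3 ^ k \<le> n" and "\<And>v. v < n \<Longrightarrow> pdt_over n (c v)"
  shows "pdt_over n (reduce_tree k s c)"
  using assms by (induction k arbitrary: s c) auto

text \<open>\<open>3 ^ k div 2\<close> counts the gates: \<open>h\<close> gates in each of three
  blocks and one on top give \<open>3 * h + 1\<close>.\<close>

lemma pdt_depth_reduce_tree:
  assumes "\<And>v. pdt_depth (c v) \<le> d"
  shows "pdt_depth (reduce_tree k s c) \<le> 3 ^ k div 2 + d"
  using assms
proof (induction k arbitrary: s c d)
  case (Suc k)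
  define h where "h = (3::nat) ^ k div 2"
  have "odd ((3::nat) ^ k)" by simp
  then have "3 ^ Suc k div 2 = h + (h + (h + 1))"
    unfolding h_def by (elim oddE) simp
  moreover have "pdt_depth (reduce_tree (Suc k) s c) \<le> h + (h + (h + Suc d))"
    unfolding reduce_tree.simps h_def
    using Suc.prems by (intro Suc.IH) simp
  ultimately show ?case by simp
qed simp

text \<open>The variable found depends on \<open>x\<close> through the path taken. Its range is
  recorded so that variables from different blocks are distinct.\<close>

lemma pdt_eval_reduce_tree:
  assumes "s + 3 ^ k \<le> length x"
  shows "\<exists>v\<in>{s..<s + 3 ^ k}. x ! v = (rec_maj3 k (take (3 ^ k) (drop s x)) = -1)
    \<and> pdt_eval (reduce_tree k s c) x = pdt_eval (c v) x"
  using assms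
proof (induction k arbitrary: s c)
  case 0
  then show ?case by simp
next
  case (Suc k)
  define m where "m = (3::nat) ^ k"
  define r where "r i = (rec_maj3 k (take m (drop i x)) = -1)" for i
  define c3 where "c3 u v w = Node {u, v} (c u) (c w)" for u v w
  define c2 where "c2 u v = reduce_tree k (s + 2 * m) (c3 u v)" for u v
  define c1 where "c1 u = reduce_tree k (s + m) (c2 u)" for u
  have len: "s + 3 * m \<le> length x"
    using Suc.prems by (simp add: m_def)
  have IH: "\<exists>v\<in>{i..<i + m}. x ! v = r i \<and> pdt_eval (reduce_tree k i c') x = pdt_eval (c' v) x"
    if "i + m \<le> length x" for i c'
    using Suc.IH[of i c'] that by (simp add: m_def r_def)
  obtain u where u: "u \<in> {s..<s + m}" "x ! u = r s"
      "pdt_eval (reduce_tree k s c1) x = pdt_eval (c1 u) x"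
    using IH[of s c1] len by auto
  obtain v where v: "v \<in> {s + m..<s + m + m}" "x ! v = r (s + m)"
      "pdt_eval (c1 u) x = pdt_eval (c2 u v) x"
    using IH[of "s + m" "c2 u"] len unfolding c1_def by auto
  obtain w where w: "w \<in> {s + 2 * m..<s + 2 * m + m}" "x ! w = r (s + 2 * m)"
      "pdt_eval (c2 u v) x = pdt_eval (c3 u v w) x"
    using IH[of "s + 2 * m" "c3 u v"] len unfolding c2_def by auto
  have "reduce_tree (Suc k) s c = reduce_tree k s c1"
    by (simp add: c1_def[abs_def] c2_def[abs_def] c3_def[abs_def] m_def)
  then have eval: "pdt_eval (reduce_tree (Suc k) s c) x = pdt_eval (c3 u v w) x"
    using u v w by simp
  have "u \<noteq> v" using u v by auto
  then have "{i \<in> {u, v}. x ! i}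
      = (if x ! u then if x ! v then {u, v} else {u} else if x ! v then {v} else {})"
    by auto
  then have parity: "parity {u, v} x \<longleftrightarrow> x ! u \<noteq> x ! v"
    using \<open>u \<noteq> v\<close> by (simp add: parity_def)
  have "m + (m + s) = s + 2 * m"
    by simp
  then have "take (m + (m + m)) (drop s x)
      = take m (drop s x) @ take m (drop (s + m) x) @ take m (drop (s + 2 * m) x)"
    by (simp only: take_add drop_drop add.assoc add.commute[of s m])
  moreover have "m + (m + m) = 3 ^ Suc k"
    by (simp add: m_def)
  ultimately have "take (3 ^ Suc k) (drop s x)
      = take m (drop s x) @ take m (drop (s + m) x) @ take m (drop (s + 2 * m) x)"
    by simp
  then have "rec_maj3 (Suc k) (take (3 ^ Suc k) (drop s x)) = maj3 (r s) (r (s + m)) (r (s + 2 * m))"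
    using len by (simp only: r_def) (intro rec_maj3_append; simp add: m_def)
  \<comment> \<open>If the bits at \<open>u\<close> and \<open>v\<close> agree they form the
    majority; otherwise they cancel and the bit at \<open>w\<close> decides.\<close>
  then have "(if parity {u, v} x then x ! w else x ! u)
      = (rec_maj3 (Suc k) (take (3 ^ Suc k) (drop s x)) = -1)"
    unfolding parity u(2) v(2) w(2) by (auto simp: maj3_def)
  then show ?case
    unfolding eval using u(1) w(1)
    by (intro bexI[of _ "if parity {u, v} x then w else u"]) (auto simp: c3_def m_def)
qed

lemma rec_maj3_tree:
  "\<exists>t. pdt_computes (3 ^ k) t (rec_maj3 k) \<and> pdt_depth t \<le> 3 ^ k div 2 + 1"
proof (intro exI conjI)
  let ?c = "\<lambda>v. Node {v} (Leaf 1) (Leaf (-1))"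
  let ?t = "reduce_tree k 0 ?c"
  show "pdt_depth ?t \<le> 3 ^ k div 2 + 1"
    by (rule pdt_depth_reduce_tree) simp
  have "pdt_eval ?t x = rec_maj3 k x" if "x \<in> cube (3 ^ k)" for x
  proof -
    have len: "length x = 3 ^ k" using that by (simp add: cube_def)
    then obtain v where "x ! v = (rec_maj3 k x = -1)" "pdt_eval ?t x = pdt_eval (?c v) x"
      using pdt_eval_reduce_tree[of 0 k x ?c] by auto
    moreover have "{i. i = v \<and> x ! i} = (if x ! v then {v} else {})"
      by auto
    ultimately show ?thesis
      using rec_maj3_range[of k x] by (auto simp: parity_def)
  qed
  then show "pdt_computes (3 ^ k) ?t (rec_maj3 k)"
    by (simp add: pdt_computes_def pdt_over_reduce_tree)
qed

theorem theorem13: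
  fixes k n :: nat
  assumes "k \<ge> 1" and "n = 3 ^ k"
  shows "real (D_parity n (rec_maj3 k)) = (real n + 1) / 2"
proof -
  let ?P = "\<lambda>d. \<exists>t. pdt_computes n t (rec_maj3 k) \<and> pdt_depth t = d"
  obtain t where t: "?P (pdt_depth t)" "pdt_depth t \<le> n div 2 + 1"
    using rec_maj3_tree[of k] unfolding assms(2) by blast
  have "D_parity n (rec_maj3 k) \<le> n div 2 + 1"
    unfolding D_parity_def using Least_le[of ?P, OF t(1)] t(2) by linarith
  moreover have "n + 1 \<le> 2 * D_parity n (rec_maj3 k)"
    unfolding D_parity_def using LeastI[of ?P, OF t(1)] pdt_depth_lower[of k]
    unfolding assms(2) by metis
  \<comment> \<open>For odd \<open>n\<close>, \<open>n div 2 + 1\<close> is exactly half of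
    \<open>n + 1\<close>, so the two bounds meet.\<close>
  moreover have "odd n" unfolding assms(2) by simp
  ultimately have "2 * D_parity n (rec_maj3 k) = n + 1"
    by (elim oddE) simp
  then have "2 * real (D_parity n (rec_maj3 k)) = real n + 1"
    by (metis of_nat_mult of_nat_numeral of_nat_add of_nat_1)
  then show ?thesis by simp
qed

end
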